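(* Let $f:\mathbb{R}^n\to\mathbb{R}^n$ and $G:\mathbb{R}^n\to\mathbb{R}^m$ be continuously differentiable, let $\mathcal M=\{x\in\mathbb{R}^n:G(x)=0\}$, and let $x_e\in\mathcal M$ be an equilibrium of $\dot x=f(x)$ such that $\frac{\partial G}{\partial x}(x_e)$ has full row rank. Let $\bar A=\frac{\partial f}{\partial x}(x_e)$ and $\bar{\mathbf V}=\{\bar x\in\mathbb{R}^n:\frac{\partial G}{\partial x}(x_e)\bar x=0\}$. If the linear system $\dot{\bar x}=\bar A\bar x$ restricted to $\bar{\mathbf V}$ is asymptotically stable, then the nonlinear system $\dot x=f(x)$ restricted to $\mathcal M$ is exponentially stable at $x_e$.
   Context: Linear restricted stability: $\dot{\bar x}=\bar A\bar x$ restricted to $\bar{\mathbf V}$ is asymptotically stable if every trajectory $\bar x(t)$ with $\bar x(t)\in\bar{\mathbf V}$ for all $t\ge0$ tends to $0$. Nonlinear restricted stability: $\dot x=f(x)$ restricted to $\mathcal M$ is exponentially stable at $x_e$ if there is a neighbourhood $B(x_e)$ of $x_e$ such that for every trajectory $x^*(t)$ of $\dot x=f(x)$ with $x^*(0)\in B(x_e)\cap\mathcal M$ and $x^*(t)\in\mathcal M$ for all $t\ge0$, there exist constants $\alpha,\beta>0$ with $\|x^*(t)-x_e\|\le\alpha e^{-\beta t}$ for all $t\ge0$. *)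

theory Defs
  imports "HOL-Analysis.Analysis"
begin

text \<open>A trajectory of xdot = F x on [0, infinity).\<close>
definition is_trajectory :: "(real^'n \<Rightarrow> real^'n) \<Rightarrow> (real \<Rightarrow> real^'n) \<Rightarrow> bool" where
  "is_trajectory F x \<longleftrightarrow>
     (\<forall>t\<ge>0. (x has_vector_derivative F (x t)) (at t within {0..}))"

text \<open>Linear restricted stability: xdot = A x restricted to V is asymptotically stable.\<close>
definition lin_restricted_asym_stable :: "real^'n^'n \<Rightarrow> (real^'n) set \<Rightarrow> bool" where
  "lin_restricted_asym_stable A V \<longleftrightarrow>
     (\<forall>x. is_trajectory (\<lambda>v. A *v v) x \<and> (\<forall>t\<ge>0. x t \<in> V) \<longrightarrow> (x \<longlongrightarrow> 0) at_top)"

text \<open>Nonlinear restricted exponential stability of xdot = f x restricted to M at xe.\<close>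
definition restricted_exp_stable :: "(real^'n \<Rightarrow> real^'n) \<Rightarrow> (real^'n) set \<Rightarrow> real^'n \<Rightarrow> bool" where
  "restricted_exp_stable f M xe \<longleftrightarrow>
     (\<exists>B. open B \<and> xe \<in> B \<and>
        (\<forall>x. is_trajectory f x \<and> x 0 \<in> B \<inter> M \<and> (\<forall>t\<ge>0. x t \<in> M) \<longrightarrow>
           (\<exists>\<alpha>>0. \<exists>\<beta>>0. \<forall>t\<ge>0. norm (x t - xe) \<le> \<alpha> * exp (- \<beta> * t))))"

end

theory Submission
  imports Defs
begin

text \<open>
  Write \<open>\<Phi>(t) = e\<^sup>t\<^sup>A\<close> and \<open>C = \<partial>G/\<partial>x(x\<^sub>e)\<close>. The solutions of the linearisation
  that stay in \<open>ker C\<close> start in the unobservable subspace \<open>W = {w. \<forall>t\<ge>0. C \<Phi>(t) w = 0}\<close>,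
  so by hypothesis they decay, uniformly on the finite-dimensional space \<open>W\<close>; on its orthogonal
  complement the outputs \<open>C \<Phi>(t) w\<close> at finitely many times \<open>t \<in> F\<close> bound \<open>w\<close>. Hence
  \<open>|\<Phi>(T) w| \<le> |w|/4 + K \<Sum>\<^sub>t\<^sub>\<in>\<^sub>F |C \<Phi>(t) w|\<close> for some period \<open>T\<close>.
  A nonlinear trajectory in \<open>\<M>\<close> starting near \<open>x\<^sub>e\<close> stays, by Gronwall, within
  \<open>O(\<eta> |x(s) - x\<^sub>e|)\<close> of the linear one over a period, where \<open>\<eta>\<close> bounds the linearisation
  errors of \<open>f\<close> and \<open>G\<close>; since \<open>G(x(t)) = 0\<close>, the outputs \<open>C (x(t) - x\<^sub>e)\<close> are \<open>O(\<eta>)\<close> too.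
  For small \<open>\<eta>\<close> the distance to \<open>x\<^sub>e\<close> therefore halves every period, which gives
  exponential decay.
\<close>

subsection \<open>The flow of a linear vector field\<close>

lemma bounded_linear_funpow:
  fixes L :: "'a::real_normed_vector \<Rightarrow> 'a"
  assumes "bounded_linear L"
  shows "bounded_linear (L ^^ k)"
  by (induction k) (simp_all add: id_def comp_def bounded_linear_ident bounded_linear_compose[OF assms])

lemma norm_funpow_le:
  fixes L :: "'a::real_normed_vector \<Rightarrow> 'a"
  assumes "\<And>v. norm (L v) \<le> a * norm v" "0 \<le> a"
  shows "norm ((L ^^ k) w) \<le> a ^ k * norm w"
proof (induction k)
  case (Suc k)
  have "norm ((L ^^ Suc k) w) \<le> a * norm ((L ^^ k) w)" using assms(1) by simp
  also have "\<dots> \<le> a * (a ^ k * norm w)" using Suc assms(2) by (rule mult_left_mono)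
  finally show ?case by simp
qed simp

text \<open>\<open>lin_flow L t = exp (t L)\<close>; the library has no Banach-algebra structure on matrices or on
  bounded operators, so the exponential is given by its power series.\<close>

definition lin_flow :: "('a::euclidean_space \<Rightarrow> 'a) \<Rightarrow> real \<Rightarrow> 'a \<Rightarrow> 'a" where
  "lin_flow L t w = (\<Sum>k. (t ^ k / fact k) *\<^sub>R (L ^^ k) w)"

context
  fixes L :: "'a::euclidean_space \<Rightarrow> 'a"
  assumes L: "bounded_linear L"
begin

lemma summable_lin_flow: "summable (\<lambda>k. (t ^ k / fact k) *\<^sub>R (L ^^ k) w)"
proof -
  obtain a where a: "a > 0" "\<And>v. norm (L v) \<le> a * norm v"
    using bounded_linear.pos_bounded[OF L] by (auto simp: mult.commute)
  show ?thesis
  proof (rule summable_comparison_test'[OF summable_mult2[OF summable_exp_generic]])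
    fix k :: nat
    have "norm ((t ^ k / fact k) *\<^sub>R (L ^^ k) w) = (\<bar>t\<bar> ^ k / fact k) * norm ((L ^^ k) w)"
      by (simp add: power_abs)
    also have "\<dots> \<le> (\<bar>t\<bar> ^ k / fact k) * (a ^ k * norm w)"
      using a by (intro mult_left_mono norm_funpow_le) auto
    also have "\<dots> = ((\<bar>t\<bar> * a) ^ k /\<^sub>R fact k) * norm w"
      by (simp add: power_mult_distrib divide_inverse)
    finally show "norm ((t ^ k / fact k) *\<^sub>R (L ^^ k) w) \<le> ((\<bar>t\<bar> * a) ^ k /\<^sub>R fact k) * norm w" .
  qed
qed

lemma lin_flow_apply_suminf:
  assumes "bounded_linear M"
  shows "M (lin_flow L t w) = (\<Sum>k. (t ^ k / fact k) *\<^sub>R M ((L ^^ k) w))"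
  unfolding lin_flow_def bounded_linear.suminf[OF assms summable_lin_flow]
  using linear_scale[OF bounded_linear.linear[OF assms]] by simp

lemma linear_lin_flow: "linear (lin_flow L t)"
proof (rule linearI)
  have lin: "linear (L ^^ k)" for k
    using bounded_linear_funpow[OF L] by (rule bounded_linear.linear)
  show "lin_flow L t (x + y) = lin_flow L t x + lin_flow L t y" for x y
    unfolding lin_flow_def suminf_add[OF summable_lin_flow summable_lin_flow]
    by (simp add: linear_add[OF lin] scaleR_add_right)
  show "lin_flow L t (c *\<^sub>R x) = c *\<^sub>R lin_flow L t x" for c x
    using lin_flow_apply_suminf[OF bounded_linear_scaleR_right, of c t x]
    by (simp add: lin_flow_def linear_scale[OF lin] mult.commute)
qed

lemma lin_flow_0 [simp]: "lin_flow L 0 w = w"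
proof -
  have "(\<lambda>k. ((0::real) ^ k / fact k) *\<^sub>R (L ^^ k) w) = (\<lambda>k. if k = 0 then w else 0)"
    by (rule ext) (simp add: power_0_left)
  then have "(\<lambda>k. ((0::real) ^ k / fact k) *\<^sub>R (L ^^ k) w) sums w"
    using sums_single[of 0 "\<lambda>_. w"] by simp
  then show ?thesis
    unfolding lin_flow_def by (rule sums_unique[symmetric])
qed

lemma lin_flow_has_vector_derivative:
  "((\<lambda>t. lin_flow L t w) has_vector_derivative L (lin_flow L t w)) (at t)"
  unfolding has_vector_derivative_def
proof (subst has_derivative_componentwise_within, intro ballI)
  fix b :: 'a assume "b \<in> Basis"
  \<comment> \<open>each coordinate is a real power series in \<open>t\<close>, differentiable termwise\<close>
  define c where "c k = ((L ^^ k) w \<bullet> b) / fact k" for k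
  have coord: "lin_flow L s w \<bullet> b = (\<Sum>k. c k * s ^ k)" for s
    using lin_flow_apply_suminf[OF bounded_linear_inner_left, of s w b]
    by (simp add: c_def mult.commute)
  have "summable (\<lambda>k. c k * s ^ k)" for s
    using bounded_linear.summable[OF bounded_linear_inner_left summable_lin_flow, of s w b]
    by (simp add: c_def mult.commute)
  then have "DERIV (\<lambda>s. \<Sum>k. c k * s ^ k) t :> (\<Sum>k. diffs c k * t ^ k)"
    by (rule termdiffs_strong_converges_everywhere)
  moreover have "(\<Sum>k. diffs c k * t ^ k) = L (lin_flow L t w) \<bullet> b"
    using lin_flow_apply_suminf[OF bounded_linear_compose[OF bounded_linear_inner_left L], of t w b]
    by (simp add: diffs_def c_def mult.commute linear_scale[OF bounded_linear.linear[OF L]])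
  ultimately have "DERIV (\<lambda>s. lin_flow L s w \<bullet> b) t :> L (lin_flow L t w) \<bullet> b"
    by (simp add: coord)
  then show "((\<lambda>s. lin_flow L s w \<bullet> b) has_derivative
      (\<lambda>h. (h *\<^sub>R L (lin_flow L t w)) \<bullet> b)) (at t)"
    by (simp add: has_field_derivative_def mult.commute[of _ "L (lin_flow L t w) \<bullet> b"])
qed

end

subsection \<open>Observability of the linearisation\<close>

lemma subspace_INT_eq_finite_INT:
  fixes S :: "'i \<Rightarrow> 'a::euclidean_space set"
  assumes "\<And>i. i \<in> I \<Longrightarrow> subspace (S i)"
  obtains F where "finite F" "F \<subseteq> I" "(\<Inter>i\<in>F. S i) = (\<Inter>i\<in>I. S i)"
proof -
  have sub: "subspace (\<Inter>i\<in>J. S i)" if "J \<subseteq> I" for J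
    using assms that by (intro subspace_Inter) auto
  obtain F where F: "finite F" "F \<subseteq> I"
    and min: "\<And>J. finite J \<Longrightarrow> J \<subseteq> I \<Longrightarrow> dim (\<Inter>i\<in>F. S i) \<le> dim (\<Inter>i\<in>J. S i)"
    using ex_has_least_nat[of "\<lambda>J. finite J \<and> J \<subseteq> I" "{}" "\<lambda>J. dim (\<Inter>i\<in>J. S i)"] by auto
  have "(\<Inter>i\<in>F. S i) \<subseteq> S j" if "j \<in> I" for j
  proof -
    have "(\<Inter>i\<in>insert j F. S i) = (\<Inter>i\<in>F. S i)"
      using F that min[of "insert j F"] by (intro subspace_dim_equal sub) auto
    then show ?thesis by auto
  qed
  with F that show thesis by blast
qed

lemma uniform_decay_on_subspace:
  fixes \<Phi> :: "real \<Rightarrow> 'a::euclidean_space \<Rightarrow> 'b::real_normed_vector"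
  assumes "subspace W" and lin: "\<And>t. linear (\<Phi> t)"
    and decay: "\<And>w. w \<in> W \<Longrightarrow> ((\<lambda>t. \<Phi> t w) \<longlongrightarrow> 0) at_top" and "\<epsilon> > 0"
  obtains T where "\<And>t w. t \<ge> T \<Longrightarrow> w \<in> W \<Longrightarrow> norm (\<Phi> t w) \<le> \<epsilon> * norm w"
proof -
  obtain B where B: "B \<subseteq> W" "pairwise orthogonal B" "\<And>b. b \<in> B \<Longrightarrow> norm b = 1"
    "independent B" "span B = W"
    using orthonormal_basis_subspace[OF \<open>subspace W\<close>] by metis
  have "finite B" using B(4) by (rule finiteI_independent)
  have "((\<lambda>t. \<Sum>b\<in>B. norm (\<Phi> t b)) \<longlongrightarrow> (\<Sum>b\<in>B. norm (0::'b))) at_top"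
    using B(1) decay by (intro tendsto_sum tendsto_norm) auto
  then have "\<forall>\<^sub>F t in at_top. (\<Sum>b\<in>B. norm (\<Phi> t b)) < \<epsilon>"
    using \<open>\<epsilon> > 0\<close> by (intro order_tendstoD) auto
  then obtain T where T: "\<And>t. t \<ge> T \<Longrightarrow> (\<Sum>b\<in>B. norm (\<Phi> t b)) < \<epsilon>"
    by (auto simp: eventually_at_top_linorder)
  have "norm (\<Phi> t w) \<le> \<epsilon> * norm w" if "t \<ge> T" "w \<in> W" for t w
  proof -
    have "w = (\<Sum>b\<in>B. (w \<bullet> b) *\<^sub>R b)"
      using orthonormal_basis_expand[OF B(2,3) _ \<open>finite B\<close>] that B(5) by auto
    then have "\<Phi> t w = (\<Sum>b\<in>B. (w \<bullet> b) *\<^sub>R \<Phi> t b)"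
      by (metis (no_types, lifting) lin linear_scale linear_sum sum.cong)
    then have "norm (\<Phi> t w) \<le> (\<Sum>b\<in>B. norm ((w \<bullet> b) *\<^sub>R \<Phi> t b))"
      by (metis norm_sum)
    also have "\<dots> \<le> (\<Sum>b\<in>B. norm w * norm (\<Phi> t b))"
    proof (rule sum_mono)
      fix b assume "b \<in> B"
      then have "\<bar>w \<bullet> b\<bar> \<le> norm w" using Cauchy_Schwarz_ineq2[of w b] B(3) by simp
      then show "norm ((w \<bullet> b) *\<^sub>R \<Phi> t b) \<le> norm w * norm (\<Phi> t b)"
        by (simp add: mult_right_mono)
    qed
    also have "\<dots> \<le> norm w * \<epsilon>"
      using T[OF that(1)] by (simp add: sum_distrib_left[symmetric] mult_left_mono)
    finally show ?thesis by (simp add: mult.commute)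
  qed
  then show thesis by (rule that)
qed

lemma norm_le_positive_homogeneous_on_subspace:
  fixes g :: "'a::euclidean_space \<Rightarrow> real"
  assumes "subspace S" "continuous_on S g"
    and homog: "\<And>c q. q \<in> S \<Longrightarrow> g (c *\<^sub>R q) = \<bar>c\<bar> * g q"
    and pos: "\<And>q. q \<in> S \<Longrightarrow> q \<noteq> 0 \<Longrightarrow> g q > 0"
  obtains c where "c > 0" "\<And>q. q \<in> S \<Longrightarrow> c * norm q \<le> g q"
proof (cases "S \<inter> sphere 0 1 = {}")
  case True
  have "S = {0}"
  proof -
    have "q = 0" if "q \<in> S" for q
      using True subspace_scale[OF \<open>subspace S\<close> that, of "inverse (norm q)"] by (cases "q = 0") auto
    then show ?thesis using subspace_0[OF \<open>subspace S\<close>] by blast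
  qed
  then show thesis using homog[of 0 0] by (intro that[of 1]) auto
next
  case False
  have "compact (S \<inter> sphere 0 1)"
    by (intro closed_Int_compact closed_subspace \<open>subspace S\<close> compact_sphere)
  then obtain q0 where q0: "q0 \<in> S \<inter> sphere 0 1" "\<And>q. q \<in> S \<inter> sphere 0 1 \<Longrightarrow> g q0 \<le> g q"
    using continuous_attains_inf[OF _ False continuous_on_subset[OF \<open>continuous_on S g\<close>]] by blast
  have "g q0 * norm q \<le> g q" if "q \<in> S" for q
  proof (cases "q = 0")
    case True then show ?thesis using homog[OF that, of 0] by simp
  next
    case False
    then have "g q0 \<le> g (q /\<^sub>R norm q)"
      using that subspace_scale[OF \<open>subspace S\<close>] by (intro q0(2)) auto
    also have "\<dots> = g q / norm q"
      using homog[OF that, of "inverse (norm q)"] by (simp add: divide_inverse mult.commute)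
    finally show ?thesis using False by (simp add: field_simps)
  qed
  moreover have "g q0 > 0" using q0(1) by (intro pos) auto
  ultimately show thesis by (intro that[of "g q0"]) (auto simp: mult.commute)
qed

lemma norm_le_sum_norm_on_orthogonal_comp_kernels:
  fixes \<Psi> :: "'i \<Rightarrow> 'a::euclidean_space \<Rightarrow> 'b::real_normed_vector"
  assumes "finite F" and lin: "\<And>i. linear (\<Psi> i)"
    and W: "\<And>w. w \<in> W \<longleftrightarrow> (\<forall>i\<in>F. \<Psi> i w = 0)"
  obtains c where "c > 0" "\<And>q. q \<in> W\<^sup>\<bottom> \<Longrightarrow> c * norm q \<le> (\<Sum>i\<in>F. norm (\<Psi> i q))"
proof (rule norm_le_positive_homogeneous_on_subspace[OF subspace_orthogonal_comp])
  show "continuous_on (W\<^sup>\<bottom>) (\<lambda>q. \<Sum>i\<in>F. norm (\<Psi> i q))"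
    using lin by (intro continuous_intros linear_continuous_on) (simp add: linear_conv_bounded_linear)
  show "(\<Sum>i\<in>F. norm (\<Psi> i (c *\<^sub>R q))) = \<bar>c\<bar> * (\<Sum>i\<in>F. norm (\<Psi> i q))" for c q
    by (simp add: linear_scale[OF lin] sum_distrib_left)
  have "subspace W"
    by (auto simp: subspace_def W linear_0[OF lin] linear_add[OF lin] linear_scale[OF lin])
  show "(\<Sum>i\<in>F. norm (\<Psi> i q)) > 0" if "q \<in> W\<^sup>\<bottom>" "q \<noteq> 0" for q
  proof (rule ccontr)
    assume "\<not> (\<Sum>i\<in>F. norm (\<Psi> i q)) > 0"
    then have "(\<Sum>i\<in>F. norm (\<Psi> i q)) = 0" by (simp add: order.antisym sum_nonneg not_less)
    then have "q \<in> W \<inter> W\<^sup>\<bottom>" using \<open>finite F\<close> that(1) by (simp add: W sum_nonneg_eq_0_iff)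
    then show False using orthogonal_Int_0[OF \<open>subspace W\<close>] that(2) by blast
  qed
qed (rule that)

lemma norm_le_on_orthogonal_decomposition:
  fixes M :: "'a::euclidean_space \<Rightarrow> 'b::real_normed_vector"
  assumes "subspace W" "linear M" "\<epsilon> \<ge> 0"
    and on_W: "\<And>y. y \<in> W \<Longrightarrow> norm (M y) \<le> \<epsilon> * norm y"
    and on_comp: "\<And>z. z \<in> W\<^sup>\<bottom> \<Longrightarrow> norm (M z) \<le> K * g z"
    and g_W: "\<And>y z. y \<in> W \<Longrightarrow> g (y + z) = g z"
  shows "norm (M w) \<le> \<epsilon> * norm w + K * g w"
proof -
  obtain y z where yz: "w = y + z" "y \<in> W" "z \<in> W\<^sup>\<bottom>"
    using subspace_sum_orthogonal_comp[OF \<open>subspace W\<close>] set_plus_elim by blast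
  then have "(norm w)\<^sup>2 = (norm y)\<^sup>2 + (norm z)\<^sup>2"
    by (simp add: norm_add_Pythagorean orthogonal_comp_def)
  then have "norm y \<le> norm w" by (simp add: power2_le_imp_le)
  have "norm (M w) \<le> norm (M y) + norm (M z)"
    using linear_add[OF \<open>linear M\<close>] yz(1) by (simp add: norm_triangle_ineq)
  also have "\<dots> \<le> \<epsilon> * norm w + K * g z"
  proof (rule add_mono)
    show "norm (M y) \<le> \<epsilon> * norm w"
      using on_W[OF yz(2)] mult_left_mono[OF \<open>norm y \<le> norm w\<close> \<open>\<epsilon> \<ge> 0\<close>] by (rule order_trans)
  qed (rule on_comp[OF yz(3)])
  also have "g z = g w" using g_W[OF yz(2), of z] yz(1) by simp
  finally show ?thesis .
qed

lemma lin_flow_observability_estimate: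
  fixes L :: "'a::euclidean_space \<Rightarrow> 'a" and C :: "'a \<Rightarrow> 'b::real_normed_vector"
  assumes L: "bounded_linear L" and C: "bounded_linear C" and "\<epsilon> > 0"
    and decay: "\<And>w. \<forall>t\<ge>0. C (lin_flow L t w) = 0 \<Longrightarrow> ((\<lambda>t. lin_flow L t w) \<longlongrightarrow> 0) at_top"
  obtains T F K where "T > 0" "finite F" "F \<subseteq> {0..T}" "K \<ge> 0"
    "\<And>w. norm (lin_flow L T w) \<le> \<epsilon> * norm w + K * (\<Sum>t\<in>F. norm (C (lin_flow L t w)))"
proof -
  have lin_out: "linear (\<lambda>w. C (lin_flow L t w))" for t
    using linear_compose[OF linear_lin_flow[OF L] bounded_linear.linear[OF C]] by (simp add: o_def)
  define Z where "Z t = {w. C (lin_flow L t w) = 0}" for t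
  have sub_Z: "subspace (Z t)" for t
    unfolding subspace_def Z_def
    by (simp add: linear_0[OF lin_out] linear_add[OF lin_out] linear_scale[OF lin_out])
  define W where "W = (\<Inter>t\<in>{0..}. Z t)"
  have "subspace W" unfolding W_def using sub_Z by (intro subspace_Inter) auto
  obtain F where F: "finite F" "F \<subseteq> {0..}" and W_F: "(\<Inter>t\<in>F. Z t) = W"
    unfolding W_def using subspace_INT_eq_finite_INT[of "{0..}" Z] sub_Z by blast
  then have mem_W: "w \<in> W \<longleftrightarrow> (\<forall>t\<in>F. C (lin_flow L t w) = 0)" for w
    by (auto simp: Z_def)
  obtain T0 where T0: "\<And>t w. t \<ge> T0 \<Longrightarrow> w \<in> W \<Longrightarrow> norm (lin_flow L t w) \<le> \<epsilon> * norm w"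
    using uniform_decay_on_subspace[OF \<open>subspace W\<close> linear_lin_flow[OF L] decay \<open>\<epsilon> > 0\<close>]
    by (auto simp: W_def Z_def)
  obtain c where c: "c > 0" "\<And>q. q \<in> W\<^sup>\<bottom> \<Longrightarrow> c * norm q \<le> (\<Sum>t\<in>F. norm (C (lin_flow L t q)))"
    using norm_le_sum_norm_on_orthogonal_comp_kernels[OF F(1) lin_out mem_W] by blast
  define T where "T = max 1 (max T0 (Max (insert 0 F)))"
  have "F \<subseteq> {0..T}"
  proof
    fix t assume "t \<in> F"
    then have "0 \<le> t" "t \<le> Max (insert 0 F)" using F by auto
    then show "t \<in> {0..T}" by (auto simp: T_def)
  qed
  obtain a where a: "a > 0" "\<And>w. norm (lin_flow L T w) \<le> a * norm w"
    using bounded_linear.pos_bounded[of "lin_flow L T"] linear_lin_flow[OF L] linear_conv_bounded_linear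
    by (metis mult.commute)
  have "norm (lin_flow L T w) \<le> \<epsilon> * norm w + a / c * (\<Sum>t\<in>F. norm (C (lin_flow L t w)))" for w
  proof (rule norm_le_on_orthogonal_decomposition[OF \<open>subspace W\<close> linear_lin_flow[OF L]])
    show "norm (lin_flow L T z) \<le> a / c * (\<Sum>t\<in>F. norm (C (lin_flow L t z)))" if "z \<in> W\<^sup>\<bottom>" for z
    proof -
      have "norm (lin_flow L T z) \<le> a / c * (c * norm z)" using a(2)[of z] c(1) by simp
      also have "\<dots> \<le> a / c * (\<Sum>t\<in>F. norm (C (lin_flow L t z)))"
        using c(2)[OF that] a(1) c(1) by (intro mult_left_mono) auto
      finally show ?thesis .
    qed
    show "(\<Sum>t\<in>F. norm (C (lin_flow L t (y + z)))) = (\<Sum>t\<in>F. norm (C (lin_flow L t z)))" if "y \<in> W" for y z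
      using that by (simp add: mem_W linear_add[OF lin_out])
  qed (use T0[of T] \<open>\<epsilon> > 0\<close> in \<open>simp_all add: T_def\<close>)
  moreover have "T > 0" "a / c \<ge> 0" using a c by (auto simp: T_def)
  ultimately show thesis using that F(1) \<open>F \<subseteq> {0..T}\<close> by auto
qed

subsection \<open>Gronwall estimates for trajectories\<close>

lemma has_real_derivative_inner_self:
  fixes e :: "real \<Rightarrow> 'a::real_inner"
  assumes "(e has_vector_derivative d) (at u)"
  shows "((\<lambda>u. e u \<bullet> e u) has_real_derivative 2 * (e u \<bullet> d)) (at u)"
proof -
  have e: "(e has_derivative (\<lambda>h. h *\<^sub>R d)) (at u)" using assms by (simp add: has_vector_derivative_def)
  have "((\<lambda>u. e u \<bullet> e u) has_derivative (\<lambda>h. e u \<bullet> (h *\<^sub>R d) + (h *\<^sub>R d) \<bullet> e u)) (at u)"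
    using has_derivative_inner[OF e e] .
  moreover have "(\<lambda>h. e u \<bullet> (h *\<^sub>R d) + (h *\<^sub>R d) \<bullet> e u) = (*) (2 * (e u \<bullet> d))"
    by (auto simp: inner_commute)
  ultimately show ?thesis by (simp add: has_field_derivative_def)
qed

lemma gronwall_norm_sq:
  fixes e :: "real \<Rightarrow> 'a::real_inner"
  assumes "a \<le> b" "L > 0" "c \<ge> 0"
    and cont: "continuous_on {a..b} e"
    and der: "\<And>u. a < u \<Longrightarrow> u < b \<Longrightarrow> (e has_vector_derivative e' u) (at u)"
    and ineq: "\<And>u. a < u \<Longrightarrow> u < b \<Longrightarrow> e u \<bullet> e' u \<le> L * (norm (e u))\<^sup>2 + c"
  shows "(norm (e b))\<^sup>2 \<le> exp (2 * L * (b - a)) * ((norm (e a))\<^sup>2 + 2 * c * (b - a))"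
proof -
  define \<phi> where "\<phi> u = exp (- 2 * L * (u - a)) * (e u \<bullet> e u) - 2 * c * (u - a)" for u
  have "\<phi> b \<le> \<phi> a"
  proof (rule DERIV_nonpos_imp_decreasing_open[OF \<open>a \<le> b\<close>])
    fix u assume u: "a < u" "u < b"
    let ?\<phi>' = "exp (- 2 * L * (u - a)) * (- 2 * L) * (e u \<bullet> e u)
      + 2 * (e u \<bullet> e' u) * exp (- 2 * L * (u - a)) - 2 * c"
    have "((\<lambda>u. exp (- 2 * L * (u - a))) has_real_derivative exp (- 2 * L * (u - a)) * (- 2 * L)) (at u)"
      by (auto intro!: derivative_eq_intros)
    then have "(\<phi> has_real_derivative ?\<phi>') (at u)"
      unfolding \<phi>_def
      by (intro DERIV_diff DERIV_mult has_real_derivative_inner_self der u)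
        (auto intro!: derivative_eq_intros)
    moreover have "?\<phi>' = exp (- 2 * L * (u - a)) * (2 * (e u \<bullet> e' u - L * (norm (e u))\<^sup>2)) - 2 * c"
      by (simp add: power2_norm_eq_inner algebra_simps)
    moreover have "exp (- 2 * L * (u - a)) * (2 * (e u \<bullet> e' u - L * (norm (e u))\<^sup>2)) \<le> 2 * c"
    proof -
      have "exp (- 2 * L * (u - a)) * (2 * (e u \<bullet> e' u - L * (norm (e u))\<^sup>2))
          \<le> exp (- 2 * L * (u - a)) * (2 * c)"
        using ineq[OF u] by (intro mult_left_mono) auto
      also have "\<dots> \<le> 2 * c"
        using \<open>L > 0\<close> \<open>c \<ge> 0\<close> u by (simp add: mult_left_le_one_le)
      finally show ?thesis .
    qed
    ultimately show "\<exists>y. (\<phi> has_real_derivative y) (at u) \<and> y \<le> 0" by auto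
  next
    show "continuous_on {a..b} \<phi>"
      unfolding \<phi>_def by (intro continuous_intros cont)
  qed
  then have "exp (- (2 * L * (b - a))) * (norm (e b))\<^sup>2 \<le> (norm (e a))\<^sup>2 + 2 * c * (b - a)"
    by (simp add: \<phi>_def power2_norm_eq_inner)
  moreover have "N \<le> exp y * X" if "exp (- y) * N \<le> X" for y N X :: real
  proof -
    have "N = exp y * (exp (- y) * N)" by (simp add: exp_minus)
    also have "\<dots> \<le> exp y * X" using that by simp
    finally show ?thesis .
  qed
  ultimately show ?thesis by blast
qed

lemma norm_le_of_norm_sq_le_exp:
  assumes "(norm v)\<^sup>2 \<le> exp (2 * L * h) * X\<^sup>2" "X \<ge> 0"
  shows "norm v \<le> exp (L * h) * X"
proof (rule power2_le_imp_le)
  have "exp (2 * L * h) = (exp (L * h))\<^sup>2" by (simp add: exp_double[symmetric] mult.assoc)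
  then show "(norm v)\<^sup>2 \<le> (exp (L * h) * X)\<^sup>2" using assms(1) by (simp add: power_mult_distrib)
qed (use assms(2) in simp)

lemma trajectory_exp_growth:
  fixes x :: "real \<Rightarrow> 'a::real_inner"
  assumes "s \<le> t" "L > 0"
    and cont: "continuous_on {s..t} x"
    and der: "\<And>u. s < u \<Longrightarrow> u < t \<Longrightarrow> (x has_vector_derivative f (x u)) (at u)"
    and growth: "\<And>u. s < u \<Longrightarrow> u < t \<Longrightarrow> norm (f (x u)) \<le> L * norm (x u - xe)"
  shows "norm (x t - xe) \<le> exp (L * (t - s)) * norm (x s - xe)"
proof -
  have "(norm (x t - xe))\<^sup>2 \<le> exp (2 * L * (t - s)) * ((norm (x s - xe))\<^sup>2 + 2 * 0 * (t - s))"
  proof (rule gronwall_norm_sq[OF \<open>s \<le> t\<close> \<open>L > 0\<close> order_refl])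
    show "continuous_on {s..t} (\<lambda>u. x u - xe)" by (intro continuous_intros cont)
    fix u assume u: "s < u" "u < t"
    show "((\<lambda>u. x u - xe) has_vector_derivative f (x u)) (at u)"
      using der[OF u] by (auto intro!: derivative_eq_intros)
    have "(x u - xe) \<bullet> f (x u) \<le> norm (x u - xe) * norm (f (x u))" by (rule norm_cauchy_schwarz)
    also have "\<dots> \<le> norm (x u - xe) * (L * norm (x u - xe))"
      using growth[OF u] by (intro mult_left_mono) auto
    finally show "(x u - xe) \<bullet> f (x u) \<le> L * (norm (x u - xe))\<^sup>2 + 0"
      by (simp add: power2_eq_square mult_ac)
  qed
  then show ?thesis by (intro norm_le_of_norm_sq_le_exp) auto
qed

lemma trajectory_exp_bound_near_equilibrium:
  fixes x :: "real \<Rightarrow> 'a::real_inner"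
  assumes der: "\<And>u. u > s \<Longrightarrow> (x has_vector_derivative f (x u)) (at u)"
    and cont: "continuous_on {s..} x"
    and growth: "\<And>y. norm (y - xe) < \<delta> \<Longrightarrow> norm (f y) \<le> L * norm (y - xe)"
    and "L > 0" and small: "exp (L * T) * norm (x s - xe) < \<delta>"
    and t: "t \<in> {s..s + T}"
  shows "norm (x t - xe) \<le> exp (L * (t - s)) * norm (x s - xe)"
proof -
  have bound: "norm (x t - xe) \<le> exp (L * (t - s)) * norm (x s - xe)"
    if "s \<le> t" and inside: "\<And>u. s < u \<Longrightarrow> u < t \<Longrightarrow> norm (x u - xe) < \<delta>" for t
    using \<open>s \<le> t\<close> \<open>L > 0\<close> continuous_on_subset[OF cont]
    by (rule trajectory_exp_growth) (auto intro: der growth inside)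
  have inside: "norm (x t - xe) < \<delta>" if "t \<in> {s..s + T}" for t
  proof (rule ccontr)
    assume "\<not> norm (x t - xe) < \<delta>"
    define Z where "Z = {s..s + T} \<inter> (\<lambda>t. norm (x t - xe)) -` {\<delta>..}"
    have "Z \<noteq> {}" using that \<open>\<not> norm (x t - xe) < \<delta>\<close> by (auto simp: Z_def)
    moreover have "closed Z" unfolding Z_def
      by (intro continuous_closed_preimage continuous_intros continuous_on_subset[OF cont]) auto
    moreover have "bdd_below Z" by (rule bdd_belowI[of _ s]) (auto simp: Z_def)
    ultimately have "Inf Z \<in> Z" using closed_contains_Inf by blast
    \<comment> \<open>\<open>Inf Z\<close> is the first time the trajectory leaves the \<open>\<delta>\<close>-ball\<close>
    then have t1: "s \<le> Inf Z" "Inf Z \<le> s + T" "\<delta> \<le> norm (x (Inf Z) - xe)" by (auto simp: Z_def)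
    have "norm (x u - xe) < \<delta>" if "s < u" "u < Inf Z" for u
      using cInf_lower[OF _ \<open>bdd_below Z\<close>, of u] that t1 by (force simp: Z_def)
    then have "norm (x (Inf Z) - xe) \<le> exp (L * (Inf Z - s)) * norm (x s - xe)"
      using bound t1(1) by blast
    also have "\<dots> \<le> exp (L * T) * norm (x s - xe)"
      using t1 \<open>L > 0\<close> by (intro mult_right_mono) auto
    finally show False using small t1(3) by simp
  qed
  show ?thesis using t inside by (intro bound) auto
qed

lemma inner_perturbed_linear_le:
  fixes d r :: "'a::real_inner"
  assumes "\<And>v. norm (L v) \<le> a * norm v" "norm r \<le> M"
  shows "d \<bullet> (L d + r) \<le> (a + 1) * (norm d)\<^sup>2 + M\<^sup>2 / 2"
proof -
  have "d \<bullet> (L d + r) \<le> norm d * (a * norm d) + norm d * M"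
    unfolding inner_add_right
    using assms by (intro add_mono order_trans[OF norm_cauchy_schwarz] mult_left_mono) auto
  also have "norm d * M \<le> (norm d)\<^sup>2 + M\<^sup>2 / 2"
    using sum_squares_bound[of "norm d" M] zero_le_power2[of "norm d"] by linarith
  finally show ?thesis by (simp add: power2_eq_square algebra_simps)
qed

lemma trajectory_near_lin_flow:
  fixes x :: "real \<Rightarrow> 'a::euclidean_space"
  assumes der: "\<And>u. u > s \<Longrightarrow> (x has_vector_derivative f (x u)) (at u)"
    and cont: "continuous_on {s..} x"
    and L: "bounded_linear L" "\<And>v. norm (L v) \<le> a * norm v" "a > 0"
    and "T \<ge> 0" "E \<ge> 0" "\<eta> \<ge> 0"
    and bound: "\<And>t. t \<in> {s..s + T} \<Longrightarrow> norm (x t - xe) \<le> E * norm (x s - xe)"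
    and lin: "\<And>t. t \<in> {s..s + T} \<Longrightarrow> norm (f (x t) - L (x t - xe)) \<le> \<eta> * norm (x t - xe)"
    and t: "t \<in> {s..s + T}"
  shows "norm (x t - xe - lin_flow L (t - s) (x s - xe))
    \<le> exp ((a + 1) * T) * (\<eta> * E * norm (x s - xe) * (T + 1))"
proof -
  define e0 where "e0 = x s - xe"
  define M where "M = \<eta> * E * norm e0"
  define d where "d u = x u - xe - lin_flow L (u - s) e0" for u
  have "M \<ge> 0" using \<open>E \<ge> 0\<close> \<open>\<eta> \<ge> 0\<close> by (simp add: M_def)
  have flow_der: "((\<lambda>u. lin_flow L (u - s) e0) has_vector_derivative L (lin_flow L (u - s) e0)) (at u)"
    for u
  proof -
    have "((\<lambda>u. u - s) has_vector_derivative 1) (at u)" by (auto intro!: derivative_eq_intros)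
    from vector_diff_chain_at[OF this lin_flow_has_vector_derivative[OF L(1)]] show ?thesis
      by (simp add: o_def)
  qed
  have "(norm (d t))\<^sup>2 \<le> exp (2 * (a + 1) * (t - s)) * ((norm (d s))\<^sup>2 + 2 * (M\<^sup>2 / 2) * (t - s))"
  proof (rule gronwall_norm_sq)
    have "continuous_on {s..t} (\<lambda>u. lin_flow L (u - s) e0)"
      by (intro continuous_at_imp_continuous_on ballI has_vector_derivative_continuous[OF flow_der])
    then show "continuous_on {s..t} d"
      unfolding d_def by (intro continuous_intros continuous_on_subset[OF cont]) auto
    fix u assume u: "s < u" "u < t"
    show "(d has_vector_derivative f (x u) - L (lin_flow L (u - s) e0)) (at u)"
      unfolding d_def using der[of u] flow_der[of u] u by (auto intro!: derivative_eq_intros)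
    have "u \<in> {s..s + T}" using u t by auto
    \<comment> \<open>the deviation obeys the linear equation perturbed by the linearisation error\<close>
    define r where "r = f (x u) - L (x u - xe)"
    have "norm r \<le> M"
      using lin[OF \<open>u \<in> _\<close>] bound[OF \<open>u \<in> _\<close>] \<open>\<eta> \<ge> 0\<close>
      by (force simp: r_def M_def e0_def mult.assoc intro: order_trans mult_left_mono)
    have "f (x u) - L (lin_flow L (u - s) e0) = L (d u) + r"
      by (simp add: d_def r_def linear_diff[OF bounded_linear.linear[OF L(1)]])
    then show "d u \<bullet> (f (x u) - L (lin_flow L (u - s) e0)) \<le> (a + 1) * (norm (d u))\<^sup>2 + M\<^sup>2 / 2"
      using inner_perturbed_linear_le[OF L(2) \<open>norm r \<le> M\<close>] by simp
  qed (use t L(3) in auto)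
  also have "\<dots> \<le> exp (2 * (a + 1) * T) * (M * (T + 1))\<^sup>2"
  proof (rule mult_mono)
    have "T + 1 \<le> (T + 1)\<^sup>2" using \<open>T \<ge> 0\<close> by (intro self_le_power) auto
    then have "t - s \<le> (T + 1)\<^sup>2" using t by auto
    then show "(norm (d s))\<^sup>2 + 2 * (M\<^sup>2 / 2) * (t - s) \<le> (M * (T + 1))\<^sup>2"
      by (simp add: d_def e0_def lin_flow_0[OF L(1)] power_mult_distrib mult_left_mono)
  qed (use t L(3) in auto)
  finally have "norm (d t) \<le> exp ((a + 1) * T) * (M * (T + 1))"
    using \<open>M \<ge> 0\<close> \<open>T \<ge> 0\<close> by (intro norm_le_of_norm_sq_le_exp) (auto simp: mult.assoc)
  then show ?thesis by (simp add: d_def e0_def M_def mult.assoc)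
qed

subsection \<open>Exponential stability on the constraint manifold\<close>

lemma trajectory_tracks_lin_flow:
  fixes x :: "real \<Rightarrow> 'a::euclidean_space" and a T :: real
  defines "E \<equiv> exp ((a + 1) * T)"
  assumes der: "\<And>u. u > s \<Longrightarrow> (x has_vector_derivative f (x u)) (at u)"
    and cont: "continuous_on {s..} x"
    and L: "bounded_linear L" "\<And>v. norm (L v) \<le> a * norm v" "a > 0"
    and "T \<ge> 0"
    and f_lin: "\<And>y. norm (y - xe) < \<delta> \<Longrightarrow> norm (f y - L (y - xe)) \<le> \<eta> * norm (y - xe)"
    and \<eta>: "0 \<le> \<eta>" "\<eta> \<le> 1"
    and near: "E * norm (x s - xe) < \<delta>"
    and t: "t \<in> {s..s + T}"
  shows trajectory_tracks_lin_flow_bound: "norm (x t - xe) \<le> E * norm (x s - xe)"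
    and trajectory_tracks_lin_flow_deviation:
      "norm (x t - xe - lin_flow L (t - s) (x s - xe)) \<le> E * (\<eta> * E * norm (x s - xe) * (T + 1))"
proof -
  have growth: "norm (f y) \<le> (a + 1) * norm (y - xe)" if "norm (y - xe) < \<delta>" for y
  proof -
    have "norm (f y) \<le> norm (L (y - xe)) + norm (f y - L (y - xe))"
      by (rule norm_triangle_sub)
    also have "\<dots> \<le> a * norm (y - xe) + \<eta> * norm (y - xe)"
      using L(2) f_lin[OF that] by (rule add_mono)
    also have "\<dots> \<le> (a + 1) * norm (y - xe)"
      using \<eta> mult_left_le_one_le[of "norm (y - xe)" \<eta>] by (simp add: algebra_simps)
    finally show ?thesis .
  qed
  have bound: "norm (x t - xe) \<le> E * norm (x s - xe)" if "t \<in> {s..s + T}" for t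
  proof -
    have "norm (x t - xe) \<le> exp ((a + 1) * (t - s)) * norm (x s - xe)"
      using L(3) near that
      by (intro trajectory_exp_bound_near_equilibrium[OF der cont growth]) (auto simp: E_def)
    also have "\<dots> \<le> E * norm (x s - xe)"
      using that L(3) by (intro mult_right_mono) (auto simp: E_def)
    finally show ?thesis .
  qed
  then show "norm (x t - xe) \<le> E * norm (x s - xe)" using t .
  have "norm (x t - xe) < \<delta>" if "t \<in> {s..s + T}" for t
    using bound[OF that] near by simp
  then show "norm (x t - xe - lin_flow L (t - s) (x s - xe)) \<le> E * (\<eta> * E * norm (x s - xe) * (T + 1))"
    using trajectory_near_lin_flow[OF der cont L \<open>T \<ge> 0\<close> _ \<eta>(1) bound f_lin t]
    by (simp add: E_def)
qed

lemma norm_output_le_of_constraint: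
  assumes "G p = 0" "norm (p - xe) < \<delta>"
    and G_lin: "\<And>y. norm (y - xe) < \<delta> \<Longrightarrow> norm (G y - C (y - xe)) \<le> \<eta> * norm (y - xe)"
    and C: "bounded_linear C" "\<And>v. norm (C v) \<le> c * norm v"
  shows "norm (C v) \<le> \<eta> * norm (p - xe) + c * norm (p - xe - v)"
proof -
  have "C v = C (p - xe) - C (p - xe - v)"
    by (simp add: linear_diff[OF bounded_linear.linear[OF C(1)]])
  then have "norm (C v) \<le> norm (C (p - xe)) + norm (C (p - xe - v))"
    by (simp add: norm_triangle_ineq4)
  also have "norm (C (p - xe)) \<le> \<eta> * norm (p - xe)"
    using G_lin[OF assms(2)] \<open>G p = 0\<close> by simp
  finally show ?thesis using C(2)[of "p - xe - v"] by simp
qed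

lemma trajectory_halving_step:
  fixes x :: "real \<Rightarrow> 'a::euclidean_space" and G :: "'a \<Rightarrow> 'b::real_normed_vector"
    and a T :: real
  defines "E \<equiv> exp ((a + 1) * T)"
  assumes der: "\<And>u. u > s \<Longrightarrow> (x has_vector_derivative f (x u)) (at u)"
    and cont: "continuous_on {s..} x"
    and on_M: "\<And>t. t \<ge> s \<Longrightarrow> G (x t) = 0"
    and L: "bounded_linear L" "\<And>v. norm (L v) \<le> a * norm v" "a > 0"
    and C: "bounded_linear C" "\<And>v. norm (C v) \<le> c * norm v" "c \<ge> 0"
    and obs: "T > 0" "finite F" "F \<subseteq> {0..T}" "K \<ge> 0"
      "\<And>w. norm (lin_flow L T w) \<le> 1/4 * norm w + K * (\<Sum>t\<in>F. norm (C (lin_flow L t w)))"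
    and f_lin: "\<And>y. norm (y - xe) < \<delta> \<Longrightarrow> norm (f y - L (y - xe)) \<le> \<eta> * norm (y - xe)"
    and G_lin: "\<And>y. norm (y - xe) < \<delta> \<Longrightarrow> norm (G y - C (y - xe)) \<le> \<eta> * norm (y - xe)"
    and \<eta>: "0 \<le> \<eta>" "\<eta> \<le> 1" "\<eta> * (K * card F * (E + c * E * E * (T + 1)) + E * E * (T + 1)) \<le> 1/4"
    and near: "E * norm (x s - xe) < \<delta>"
  shows "(\<forall>t\<in>{s..s + T}. norm (x t - xe) \<le> E * norm (x s - xe))
    \<and> norm (x (s + T) - xe) \<le> 1/2 * norm (x s - xe)"
proof -
  define e0 where "e0 = x s - xe"
  have bound: "norm (x t - xe) \<le> E * norm e0" if "t \<in> {s..s + T}" for t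
    using trajectory_tracks_lin_flow_bound[OF der cont L _ f_lin \<eta>(1,2) _ that] obs(1) near
    by (simp add: E_def e0_def)
  have dev: "norm (x t - xe - lin_flow L (t - s) e0) \<le> E * (\<eta> * E * norm e0 * (T + 1))"
    if "t \<in> {s..s + T}" for t
    using trajectory_tracks_lin_flow_deviation[OF der cont L _ f_lin \<eta>(1,2) _ that] obs(1) near
    by (simp add: E_def e0_def)
  have inside: "norm (x t - xe) < \<delta>" if "t \<in> {s..s + T}" for t
    using bound[OF that] near by (simp add: e0_def)
  have observed: "norm (C (lin_flow L \<tau> e0)) \<le> \<eta> * norm e0 * (E + c * E * E * (T + 1))"
    if "\<tau> \<in> F" for \<tau>
  proof -
    have \<tau>: "s + \<tau> \<in> {s..s + T}" using that obs(3) by auto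
    have "norm (C (lin_flow L \<tau> e0))
        \<le> \<eta> * norm (x (s + \<tau>) - xe) + c * norm (x (s + \<tau>) - xe - lin_flow L \<tau> e0)"
      using on_M[of "s + \<tau>"] \<tau> by (intro norm_output_le_of_constraint[OF _ inside[OF \<tau>] G_lin C(1,2)]) auto
    also have "\<dots> \<le> \<eta> * (E * norm e0) + c * (E * (\<eta> * E * norm e0 * (T + 1)))"
      using bound[OF \<tau>] dev[OF \<tau>] \<eta>(1) C(3) by (intro add_mono mult_left_mono) auto
    also have "\<dots> = \<eta> * norm e0 * (E + c * E * E * (T + 1))"
      by (simp add: algebra_simps)
    finally show ?thesis .
  qed
  have "norm (x (s + T) - xe) \<le> norm (lin_flow L T e0) + norm (x (s + T) - xe - lin_flow L T e0)"
    by (rule norm_triangle_sub)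
  also have "\<dots> \<le> (1/4 * norm e0 + K * (card F * (\<eta> * norm e0 * (E + c * E * E * (T + 1)))))
      + E * (\<eta> * E * norm e0 * (T + 1))"
  proof (rule add_mono)
    have "(\<Sum>t\<in>F. norm (C (lin_flow L t e0))) \<le> card F * (\<eta> * norm e0 * (E + c * E * E * (T + 1)))"
      using sum_bounded_above[of F "\<lambda>t. norm (C (lin_flow L t e0))", OF observed] by simp
    then show "norm (lin_flow L T e0) \<le> 1/4 * norm e0 + K * (card F * (\<eta> * norm e0 * (E + c * E * E * (T + 1))))"
      using obs(5)[of e0] mult_left_mono[OF _ obs(4)] by fastforce
    show "norm (x (s + T) - xe - lin_flow L T e0) \<le> E * (\<eta> * E * norm e0 * (T + 1))"
      using dev[of "s + T"] obs(1) by simp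
  qed
  also have "\<dots> = (1/4 + \<eta> * (K * card F * (E + c * E * E * (T + 1)) + E * E * (T + 1))) * norm e0"
    by (simp add: algebra_simps)
  also have "\<dots> \<le> 1/2 * norm e0"
    using \<eta>(3) by (intro mult_right_mono) auto
  finally show ?thesis using bound by (simp add: e0_def)
qed

lemma half_power_le_exp:
  assumes "t / T < real k + 1"
  shows "(1/2::real) ^ k \<le> 2 * exp (- (ln 2 / T) * t)"
proof -
  have "ln 2 * (t / T - 1) \<le> ln 2 * real k" using assms by (intro mult_left_mono) auto
  then have "- (ln 2 * real k) \<le> ln 2 - ln 2 / T * t" by (simp add: algebra_simps)
  have "(1/2::real) ^ k = exp (- (ln 2 * real k))"
    by (simp add: exp_minus mult.commute[of "ln 2"] exp_of_nat_mult power_one_over inverse_eq_divide)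
  also have "\<dots> \<le> exp (ln 2 - ln 2 / T * t)"
    using \<open>- (ln 2 * real k) \<le> ln 2 - ln 2 / T * t\<close> by simp
  also have "\<dots> = 2 * exp (- (ln 2 / T) * t)"
    by (simp add: exp_diff exp_minus divide_inverse)
  finally show ?thesis .
qed

lemma exp_decay_of_periodic_halving:
  fixes n :: "real \<Rightarrow> real"
  assumes "T > 0" "E \<ge> 0"
    and nonneg: "\<And>t. t \<ge> 0 \<Longrightarrow> n t \<ge> 0"
    and step: "\<And>s. s \<ge> 0 \<Longrightarrow> n s \<le> \<rho> \<Longrightarrow> (\<forall>t\<in>{s..s + T}. n t \<le> E * n s) \<and> n (s + T) \<le> 1/2 * n s"
    and "n 0 \<le> \<rho>"
  obtains \<alpha> \<beta> where "\<alpha> > 0" "\<beta> > 0" "\<And>t. t \<ge> 0 \<Longrightarrow> n t \<le> \<alpha> * exp (- \<beta> * t)"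
proof -
  have "n 0 \<ge> 0" using nonneg by simp
  have halved: "n (real k * T) \<le> (1/2) ^ k * n 0 \<and> n (real k * T) \<le> \<rho>" for k :: nat
  proof (induction k)
    case (Suc k)
    have "n (real k * T + T) \<le> 1/2 * n (real k * T)"
      using step[of "real k * T"] Suc \<open>T > 0\<close> by auto
    then have "n (real (Suc k) * T) \<le> (1/2) ^ Suc k * n 0"
      using Suc by (simp add: algebra_simps)
    moreover have "(1/2) ^ Suc k * n 0 \<le> n 0"
      using \<open>n 0 \<ge> 0\<close> by (intro mult_left_le_one_le power_le_one) auto
    ultimately show ?case using \<open>n 0 \<le> \<rho>\<close> by linarith
  qed (use \<open>n 0 \<le> \<rho>\<close> in simp)
  define \<beta> where "\<beta> = ln 2 / T"
  have "n t \<le> (2 * E * n 0 + 1) * exp (- \<beta> * t)" if "t \<ge> 0" for t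
  proof -
    define k where "k = nat \<lfloor>t / T\<rfloor>"
    have k: "real k \<le> t / T" "t / T < real k + 1"
      using that \<open>T > 0\<close> by (simp_all add: k_def)
    then have "t \<in> {real k * T..real k * T + T}"
      using \<open>T > 0\<close> by (simp add: field_simps)
    then have "n t \<le> E * n (real k * T)"
      using step[of "real k * T"] halved[of k] \<open>T > 0\<close> by auto
    also have "\<dots> \<le> E * ((1/2) ^ k * n 0)"
      using halved[of k] \<open>E \<ge> 0\<close> by (intro mult_left_mono) auto
    also have "(1/2::real) ^ k \<le> 2 * exp (- \<beta> * t)"
      unfolding \<beta>_def using k(2) by (rule half_power_le_exp)
    then have "E * ((1/2) ^ k * n 0) \<le> E * (2 * exp (- \<beta> * t) * n 0)"
      using \<open>E \<ge> 0\<close> \<open>n 0 \<ge> 0\<close> by (intro mult_left_mono mult_right_mono) auto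
    also have "\<dots> \<le> (2 * E * n 0 + 1) * exp (- \<beta> * t)"
      by (simp add: algebra_simps)
    finally show ?thesis .
  qed
  moreover have "2 * E * n 0 + 1 > 0"
    using \<open>E \<ge> 0\<close> \<open>n 0 \<ge> 0\<close> by (simp add: add_nonneg_pos)
  moreover have "\<beta> > 0" using \<open>T > 0\<close> by (simp add: \<beta>_def)
  ultimately show thesis by (rule that[rotated 2])
qed

lemma is_trajectoryD:
  assumes "is_trajectory f x"
  shows is_trajectory_has_vector_derivative: "\<And>u. u > 0 \<Longrightarrow> (x has_vector_derivative f (x u)) (at u)"
    and is_trajectory_continuous_on: "continuous_on {0..} x"
proof -
  show "(x has_vector_derivative f (x u)) (at u)" if "u > 0" for u
  proof -
    have "(x has_vector_derivative f (x u)) (at u within {0..})"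
      using assms that by (simp add: is_trajectory_def)
    moreover have "at u within {0..} = at u" using that by (intro at_within_interior) auto
    ultimately show ?thesis by simp
  qed
  show "continuous_on {0..} x"
    unfolding continuous_on_eq_continuous_within
  proof
    fix t :: real assume "t \<in> {0..}"
    then show "continuous (at t within {0..}) x"
      using assms by (auto simp: is_trajectory_def intro: has_vector_derivative_continuous)
  qed
qed

lemma restricted_exp_stableI:
  assumes "\<rho> > 0" "T > 0" "E \<ge> 0"
    and step: "\<And>x s. (\<And>u. u > s \<Longrightarrow> (x has_vector_derivative f (x u)) (at u)) \<Longrightarrow>
      continuous_on {s..} x \<Longrightarrow> (\<And>t. t \<ge> s \<Longrightarrow> x t \<in> M) \<Longrightarrow> norm (x s - xe) \<le> \<rho> \<Longrightarrow>
      (\<forall>t\<in>{s..s + T}. norm (x t - xe) \<le> E * norm (x s - xe)) \<and> norm (x (s + T) - xe) \<le> 1/2 * norm (x s - xe)"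
  shows "restricted_exp_stable f M xe"
  unfolding restricted_exp_stable_def
proof (intro exI[of _ "ball xe \<rho>"] conjI allI impI)
  fix x assume x: "is_trajectory f x \<and> x 0 \<in> ball xe \<rho> \<inter> M \<and> (\<forall>t\<ge>0. x t \<in> M)"
  have halving: "(\<forall>t\<in>{s..s + T}. norm (x t - xe) \<le> E * norm (x s - xe)) \<and> norm (x (s + T) - xe) \<le> 1/2 * norm (x s - xe)"
    if "s \<ge> 0" "norm (x s - xe) \<le> \<rho>" for s
  proof (rule step)
    show "continuous_on {s..} x"
      using is_trajectory_continuous_on[of f x] x that(1) by (auto elim: continuous_on_subset)
  qed (use is_trajectory_has_vector_derivative[of f x] x that in auto)
  moreover have "norm (x 0 - xe) \<le> \<rho>" using x by (simp add: dist_norm norm_minus_commute)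
  ultimately obtain \<alpha> \<beta> where "\<alpha> > 0" "\<beta> > 0"
    "\<And>t. t \<ge> 0 \<Longrightarrow> norm (x t - xe) \<le> \<alpha> * exp (- \<beta> * t)"
    using exp_decay_of_periodic_halving[where n="\<lambda>t. norm (x t - xe)", OF \<open>T > 0\<close> \<open>E \<ge> 0\<close> norm_ge_zero]
    by metis
  then show "\<exists>\<alpha>>0. \<exists>\<beta>>0. \<forall>t\<ge>0. norm (x t - xe) \<le> \<alpha> * exp (- \<beta> * t)" by blast
qed (use \<open>\<rho> > 0\<close> in auto)

lemma lin_restricted_asym_stable_lin_flow_tendsto:
  fixes A :: "real^'n^'n" and C :: "real^'n^'m"
  assumes "lin_restricted_asym_stable A {v. C *v v = 0}" "\<forall>t\<ge>0. C *v lin_flow ((*v) A) t w = 0"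
  shows "((\<lambda>t. lin_flow ((*v) A) t w) \<longlongrightarrow> 0) at_top"
proof -
  have "is_trajectory (\<lambda>v. A *v v) (\<lambda>t. lin_flow ((*v) A) t w)"
    unfolding is_trajectory_def
    using lin_flow_has_vector_derivative[OF matrix_vector_mul_bounded_linear] has_vector_derivative_at_within
    by blast
  with assms show ?thesis unfolding lin_restricted_asym_stable_def by auto
qed

lemma linearization_error_le:
  assumes "(g has_derivative g') (at x0)" "\<eta> > 0"
  obtains \<delta> where "\<delta> > 0" "\<And>y. norm (y - x0) < \<delta> \<Longrightarrow> norm (g y - g x0 - g' (y - x0)) \<le> \<eta> * norm (y - x0)"
  using assms unfolding has_derivative_at_alt by blast

lemma small_gain_exists:
  fixes Q :: real
  assumes "Q \<ge> 0"
  obtains \<eta> where "0 < \<eta>" "\<eta> \<le> 1" "\<eta> * Q \<le> 1/4"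
proof
  show "0 < min 1 (1 / (4 * (Q + 1)))" "min 1 (1 / (4 * (Q + 1))) \<le> 1" using assms by auto
  have "min 1 (1 / (4 * (Q + 1))) * Q \<le> 1 / (4 * (Q + 1)) * Q" using assms by (intro mult_right_mono) auto
  also have "\<dots> \<le> 1/4" using assms by (simp add: field_simps)
  finally show "min 1 (1 / (4 * (Q + 1))) * Q \<le> 1/4" .
qed

lemma restricted_exp_stable_of_observability_estimate:
  fixes f :: "real^'n \<Rightarrow> real^'n" and G :: "real^'n \<Rightarrow> 'b::real_normed_vector"
  assumes f_deriv: "(f has_derivative L) (at xe)" and G_deriv: "(G has_derivative C) (at xe)"
    and "f xe = 0" "G xe = 0"
    and obs: "T > 0" "finite F" "F \<subseteq> {0..T}" "K \<ge> 0"
      "\<And>w. norm (lin_flow L T w) \<le> 1/4 * norm w + K * (\<Sum>t\<in>F. norm (C (lin_flow L t w)))"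
  shows "restricted_exp_stable f {x. G x = 0} xe"
proof -
  have L: "bounded_linear L" and C: "bounded_linear C"
    using f_deriv G_deriv by (auto intro: has_derivative_bounded_linear)
  obtain a c where a: "a > 0" "\<And>v. norm (L v) \<le> a * norm v" and c: "c > 0" "\<And>v. norm (C v) \<le> c * norm v"
    using bounded_linear.pos_bounded[OF L] bounded_linear.pos_bounded[OF C] by (metis mult.commute)
  define E where "E = exp ((a + 1) * T)"
  have "K * card F * (E + c * E * E * (T + 1)) + E * E * (T + 1) \<ge> 0" using obs c by (simp add: E_def)
  then obtain \<eta> where \<eta>: "0 < \<eta>" "\<eta> \<le> 1" "\<eta> * (K * card F * (E + c * E * E * (T + 1)) + E * E * (T + 1)) \<le> 1/4"
    by (rule small_gain_exists)
  obtain \<delta>f \<delta>G where "\<delta>f > 0" "\<delta>G > 0"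
    and f_lin: "\<And>y. norm (y - xe) < \<delta>f \<Longrightarrow> norm (f y - L (y - xe)) \<le> \<eta> * norm (y - xe)"
    and G_lin: "\<And>y. norm (y - xe) < \<delta>G \<Longrightarrow> norm (G y - C (y - xe)) \<le> \<eta> * norm (y - xe)"
    using linearization_error_le[OF f_deriv \<eta>(1)] linearization_error_le[OF G_deriv \<eta>(1)]
      \<open>f xe = 0\<close> \<open>G xe = 0\<close> by (metis diff_zero)
  define \<delta> where "\<delta> = min \<delta>f \<delta>G"
  show ?thesis
  proof (rule restricted_exp_stableI[of "\<delta> / (2 * E)" T E])
    fix x s assume der: "\<And>u. u > s \<Longrightarrow> (x has_vector_derivative f (x u)) (at u)"
      and cont: "continuous_on {s..} x" and on_M: "\<And>t. t \<ge> s \<Longrightarrow> x t \<in> {x. G x = 0}"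
      and near: "norm (x s - xe) \<le> \<delta> / (2 * E)"
    have "E * norm (x s - xe) < \<delta>"
      using near \<open>\<delta>f > 0\<close> \<open>\<delta>G > 0\<close> by (simp add: \<delta>_def E_def field_simps)
    then show "(\<forall>t\<in>{s..s + T}. norm (x t - xe) \<le> E * norm (x s - xe))
      \<and> norm (x (s + T) - xe) \<le> 1/2 * norm (x s - xe)"
      using trajectory_halving_step[where \<delta>=\<delta>, OF der cont _ L a(2,1) C c(2) _ obs f_lin G_lin,
          folded E_def] on_M c(1) \<eta>
      by (auto simp: \<delta>_def)
  qed (use \<open>\<delta>f > 0\<close> \<open>\<delta>G > 0\<close> obs(1) in \<open>auto simp: \<delta>_def E_def\<close>)
qed

theorem theorem3:
  fixes f :: "real^'n \<Rightarrow> real^'n" and G :: "real^'n \<Rightarrow> real^'m"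
    and Df :: "real^'n \<Rightarrow> real^'n^'n" and DG :: "real^'n \<Rightarrow> real^'n^'m"
    and xe :: "real^'n"
  assumes f_deriv: "\<And>x. (f has_derivative (\<lambda>h. Df x *v h)) (at x)"
    and Df_cont: "continuous_on UNIV Df"
    and G_deriv: "\<And>x. (G has_derivative (\<lambda>h. DG x *v h)) (at x)"
    and DG_cont: "continuous_on UNIV DG"
    and xe_M: "G xe = 0"
    and equil: "f xe = 0"
    and full_rank: "rank (DG xe) = CARD('m)"
    and lin_stable: "lin_restricted_asym_stable (Df xe) {v. DG xe *v v = 0}"
  shows "restricted_exp_stable f {x. G x = 0} xe"
proof -
  \<comment> \<open>only differentiability at \<open>xe\<close> is needed: \<open>Df_cont\<close>, \<open>DG_cont\<close> and \<open>full_rank\<close> are unused\<close>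
  obtain T F K where "T > 0" "finite F" "F \<subseteq> {0..T}" "K \<ge> 0"
    "\<And>w. norm (lin_flow ((*v) (Df xe)) T w)
      \<le> 1/4 * norm w + K * (\<Sum>t\<in>F. norm (DG xe *v lin_flow ((*v) (Df xe)) t w))"
    by (rule lin_flow_observability_estimate[where \<epsilon>="1/4", OF _ _ _
          lin_restricted_asym_stable_lin_flow_tendsto[OF lin_stable]]) auto
  then show ?thesis
    by (rule restricted_exp_stable_of_observability_estimate[OF f_deriv G_deriv equil xe_M])
qed

end
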